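(* Let $\mathcal{H}$ be any hypothesis set, equipped with the Kronecker distance $d_{\mathrm{Kron}}(h,h')=\mathbb{1}_{h\neq h'}$, and let $\ell:\mathcal{H}\times\mathcal{Z}\to\mathbb{R}$ be $L$-Lipschitz with respect to $d_{\mathrm{Kron}}$, i.e. $|\ell(h,z)-\ell(h',z)|\le L\,\mathbb{1}_{h\ne h'}$ for all $h,h'\in\mathcal{H}$, $z\in\mathcal{Z}$. Then for any $\delta\in(0,1)$, with probability at least $1-\delta$ over $\mathcal{S}\sim\mathcal{D}^m$, the map $h\mapsto\Delta_{\mathcal{S}}(h)$ is $L(m,\delta)$-Lipschitz with respect to $d_{\mathrm{Kron}}$, where \[ L(m,\delta)=4\mathfrak{R}(\mathcal{H})+L\sqrt{\frac{2\ln\frac2\delta}{m}}. \]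
   Context: $\mathcal{Z}$ is a data space, $\mathcal{D}$ an unknown distribution on $\mathcal{Z}$, $\mathcal{S}=\{z_1,\dots,z_m\}\sim\mathcal{D}^m$ i.i.d.; $R_{\mathcal{D}}(h)=\mathbb{E}_{z\sim\mathcal{D}}\ell(h,z)$, $\hat R_{\mathcal{S}}(h)=\frac1m\sum_i\ell(h,z_i)$, $\Delta_{\mathcal{S}}(h)=|R_{\mathcal{D}}(h)-\hat R_{\mathcal{S}}(h)|$. The Rademacher complexity is $\mathfrak{R}(\mathcal{H}):=\mathbb{E}_{\mathcal{S}\sim\mathcal{D}^m}\mathbb{E}_{\varepsilon}\sup_{h\in\mathcal{H}}\frac1m\sum_{i=1}^m\varepsilon_i\ell(h,z_i)$, where $\varepsilon_1,\dots,\varepsilon_m$ are i.i.d. uniform on $\{-1,+1\}$. *)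

theory Defs
  imports "HOL-Probability.Probability"
begin

definition d_kron :: "'h \<Rightarrow> 'h \<Rightarrow> real" where
  "d_kron h h' = (if h \<noteq> h' then 1 else 0)"

definition sample_measure :: "'z measure \<Rightarrow> nat \<Rightarrow> (nat \<Rightarrow> 'z) measure" where
  "sample_measure D m = PiM {..<m} (\<lambda>_. D)"

definition rademacher_measure :: "nat \<Rightarrow> (nat \<Rightarrow> real) measure" where
  "rademacher_measure m = PiM {..<m} (\<lambda>_. measure_pmf (pmf_of_set {-1::real, 1}))"

definition true_risk :: "'z measure \<Rightarrow> ('h \<Rightarrow> 'z \<Rightarrow> real) \<Rightarrow> 'h \<Rightarrow> real" where
  "true_risk D loss h = (\<integral>z. loss h z \<partial>D)"

definition emp_risk :: "('h \<Rightarrow> 'z \<Rightarrow> real) \<Rightarrow> nat \<Rightarrow> (nat \<Rightarrow> 'z) \<Rightarrow> 'h \<Rightarrow> real" where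
  "emp_risk loss m S h = (1 / real m) * (\<Sum>i<m. loss h (S i))"

definition gen_gap :: "'z measure \<Rightarrow> ('h \<Rightarrow> 'z \<Rightarrow> real) \<Rightarrow> nat \<Rightarrow> (nat \<Rightarrow> 'z) \<Rightarrow> 'h \<Rightarrow> real" where
  "gen_gap D loss m S h = \<bar>true_risk D loss h - emp_risk loss m S h\<bar>"

definition rad_sup :: "'h set \<Rightarrow> ('h \<Rightarrow> 'z \<Rightarrow> real) \<Rightarrow> nat \<Rightarrow> (nat \<Rightarrow> 'z) \<Rightarrow> (nat \<Rightarrow> real) \<Rightarrow> real" where
  "rad_sup H loss m S \<epsilon> = (SUP h\<in>H. (1 / real m) * (\<Sum>i<m. \<epsilon> i * loss h (S i)))"

definition rademacher_complexity :: "'z measure \<Rightarrow> 'h set \<Rightarrow> ('h \<Rightarrow> 'z \<Rightarrow> real) \<Rightarrow> nat \<Rightarrow> real" where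
  "rademacher_complexity D H loss m =
     (\<integral>S. (\<integral>\<epsilon>. rad_sup H loss m S \<epsilon> \<partial>rademacher_measure m) \<partial>sample_measure D m)"

end

theory Submission
  imports Defs
begin

text \<open>
  For a sign vector \<open>\<epsilon>\<close>, let \<open>\<rho>\<^sub>\<epsilon>(S)\<close> be the oscillation over \<open>H\<close> of the signed mean of the losses on
  \<open>S\<close>, i.e. the sum of the Rademacher suprema at \<open>\<epsilon>\<close> and \<open>- \<epsilon>\<close>. Averaging over signs, some \<open>\<epsilon>\<close> has
  \<open>E \<rho>\<^sub>\<epsilon>\<close> at most twice the Rademacher complexity. Given an independent ghost sample \<open>Y\<close>, let \<open>Z\<close>
  take the coordinates of \<open>X\<close> where \<open>\<epsilon>\<close> is \<open>1\<close> and those of \<open>Y\<close> elsewhere, and let \<open>Z'\<close> be the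
  complementary mixture. Then \<open>W(X) = E\<^sub>Y (\<rho>\<^sub>\<epsilon>(Z) + \<rho>\<^sub>\<epsilon>(Z'))\<close> dominates every difference of generalization
  gaps on \<open>X\<close>, has bounded differences \<open>2 L / m\<close>, and has expectation \<open>2 E \<rho>\<^sub>\<epsilon>\<close> because \<open>Z\<close> and \<open>Z'\<close>
  are distributed like \<open>X\<close>; McDiarmid's inequality for \<open>W\<close> gives the theorem.

  The supremum of the gap differences over an uncountable \<open>H\<close> need not be measurable, so McDiarmid's
  inequality cannot be applied to it directly. \<open>W\<close> is measurable because the Rademacher suprema are.
\<close>

subsection \<open>McDiarmid's inequality\<close>

text \<open>Telescoping: switch the coordinates from \<open>y\<close> to \<open>x\<close> one at a
  time. Every intermediate point stays in the product, and switching coordinate \<open>i\<close>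
  costs at most \<open>c i\<close>.\<close>

lemma bounded_differences_imp_diff_le_sum:
  fixes f :: "('i \<Rightarrow> 'a) \<Rightarrow> real"
  assumes "finite I" and "x \<in> Pi\<^sub>E I S" and "y \<in> Pi\<^sub>E I S"
    and bd: "\<And>x i z. x \<in> Pi\<^sub>E I S \<Longrightarrow> i \<in> I \<Longrightarrow> z \<in> S i \<Longrightarrow> \<bar>f (x(i := z)) - f x\<bar> \<le> c i"
  shows "\<bar>f x - f y\<bar> \<le> sum c I"
proof -
  have "\<bar>f (\<lambda>i. if i \<in> J then x i else y i) - f y\<bar> \<le> sum c J" if "J \<subseteq> I" for J
    using finite_subset[OF that \<open>finite I\<close>] that
  proof (induction J)
    case empty
    then show ?case by simp
  next
    case (insert j J)
    define u where "u = (\<lambda>i. if i \<in> J then x i else y i)"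
    have u: "u \<in> Pi\<^sub>E I S"
      using assms(2,3) insert.prems by (auto simp: u_def PiE_iff extensional_def)
    have upd: "(\<lambda>i. if i \<in> insert j J then x i else y i) = u(j := x j)"
      by (auto simp: u_def)
    have "\<bar>f (u(j := x j)) - f u\<bar> \<le> c j"
      using u insert.prems assms(2) by (intro bd) auto
    moreover have "\<bar>f u - f y\<bar> \<le> sum c J"
      using insert by (auto simp: u_def)
    ultimately show ?case
      unfolding upd using insert.hyps by simp
  qed
  from this[of I] have "\<bar>f (\<lambda>i. if i \<in> I then x i else y i) - f y\<bar> \<le> sum c I"
    by simp
  moreover have "(\<lambda>i. if i \<in> I then x i else y i) = x"
    using assms(2,3) by (auto simp: PiE_iff extensional_def)
  ultimately show ?thesis by simp
qed

text \<open>Comparison with one fixed point shows that \<open>f\<close> is bounded, so the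
  concentration results below can assume measurability in place of integrability.\<close>

lemma bounded_differences_integrable:
  fixes f :: "('i \<Rightarrow> 'a) \<Rightarrow> real"
  assumes "finite I" and M: "\<And>i. prob_space (M i)"
    and [measurable]: "f \<in> borel_measurable (PiM I M)"
    and bd: "\<And>x i z. x \<in> space (PiM I M) \<Longrightarrow> i \<in> I \<Longrightarrow> z \<in> space (M i) \<Longrightarrow>
      \<bar>f (x(i := z)) - f x\<bar> \<le> c i"
  shows "integrable (PiM I M) f"
proof -
  interpret P: prob_space "PiM I M"
    by (intro prob_space_PiM M)
  obtain y where y: "y \<in> space (PiM I M)"
    using P.not_empty by blast
  have "norm (f x) \<le> \<bar>f y\<bar> + sum c I" if "x \<in> space (PiM I M)" for x
    using bounded_differences_imp_diff_le_sum[of I x "\<lambda>i. space (M i)" y f c] that y \<open>finite I\<close> bd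
    by (auto simp: space_PiM)
  then show ?thesis
    by (intro P.integrable_const_bound[where B = "\<bar>f y\<bar> + sum c I"]) auto
qed

text \<open>Hoeffding's lemma applied to the interval from the infimum to the supremum of
  \<open>f\<close>, whose length is at most \<open>c\<close>. This form suits the sections
  \<open>f (x(i := y))\<close>: their range moves with \<open>x\<close>, but its length stays below
  \<open>c i\<close>.\<close>

lemma Hoeffdings_lemma_oscillation:
  fixes f :: "'a \<Rightarrow> real"
  assumes "prob_space M" and [measurable]: "f \<in> borel_measurable M" and "s > 0"
    and osc: "\<And>x y. x \<in> space M \<Longrightarrow> y \<in> space M \<Longrightarrow> \<bar>f x - f y\<bar> \<le> c"
  shows "(\<integral>\<^sup>+x. exp (s * (f x - integral\<^sup>L M f)) \<partial>M) \<le> ennreal (exp (s\<^sup>2 * c\<^sup>2 / 8))"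
proof -
  interpret prob_space M by fact
  define a where "a = Inf (f ` space M)"
  define b where "b = Sup (f ` space M)"
  obtain x0 where x0: "x0 \<in> space M" using not_empty by auto
  have bb: "bdd_below (f ` space M)" "bdd_above (f ` space M)"
    using osc[OF x0]
    by (auto intro!: bdd_belowI[where m = "f x0 - c"] bdd_aboveI[where M = "f x0 + c"]
        simp: abs_le_iff algebra_simps)
  have ab: "a \<le> f x" "f x \<le> b" if "x \<in> space M" for x
    using that bb by (auto simp: a_def b_def intro: cInf_lower cSup_upper)
  have "b \<le> c + f x" if "x \<in> space M" for x
    unfolding b_def using x0 osc[OF _ that] by (intro cSUP_least) (auto simp: abs_le_iff algebra_simps)
  then have "b - c \<le> a"
    unfolding a_def using x0 by (intro cINF_greatest) (auto simp: algebra_simps)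
  moreover have "a \<le> b" using ab[OF x0] by simp
  ultimately have "(b - a)\<^sup>2 \<le> c\<^sup>2" by (intro power_mono) auto
  interpret interval_bounded_random_variable M f a b
    by unfold_locales (auto simp: ab)
  have "(\<integral>\<^sup>+x. exp (s * (f x - integral\<^sup>L M f)) \<partial>M) \<le> ennreal (exp (s\<^sup>2 * (b - a)\<^sup>2 / 8))"
    using Hoeffdings_lemma_nn_integral[OF \<open>s > 0\<close>] by simp
  also have "\<dots> \<le> ennreal (exp (s\<^sup>2 * c\<^sup>2 / 8))"
    using \<open>(b - a)\<^sup>2 \<le> c\<^sup>2\<close> by (intro ennreal_leI) (simp add: mult_left_mono)
  finally show ?thesis .
qed

text \<open>The martingale argument, one coordinate at a time. Averaging out coordinate
  \<open>i\<close> gives \<open>g\<close>, which falls under the induction hypothesis, while the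
  fluctuation of \<open>f\<close> around \<open>g\<close> falls under Hoeffding's lemma; the two
  exponential bounds multiply.\<close>

lemma bounded_differences_mgf_le:
  fixes f :: "('i \<Rightarrow> 'a) \<Rightarrow> real"
  assumes "finite I" and M: "\<And>i. prob_space (M i)" and "s > 0"
    and "f \<in> borel_measurable (PiM I M)"
    and "\<And>x i z. x \<in> space (PiM I M) \<Longrightarrow> i \<in> I \<Longrightarrow> z \<in> space (M i) \<Longrightarrow>
      \<bar>f (x(i := z)) - f x\<bar> \<le> c i"
  shows "(\<integral>\<^sup>+x. exp (s * (f x - integral\<^sup>L (PiM I M) f)) \<partial>PiM I M)
    \<le> ennreal (exp (s\<^sup>2 * (\<Sum>i\<in>I. (c i)\<^sup>2) / 8))"
  using assms(1,4,5)
proof (induction I arbitrary: f)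
  case empty
  show ?case
    by (simp add: PiM_empty nn_integral_count_space_finite lebesgue_integral_count_space_finite)
next
  case (insert i I)
  note f[measurable] = insert.prems(1)
  have bd: "\<bar>f (x(j := z)) - f x\<bar> \<le> c j"
    if "x \<in> space (PiM (insert i I) M)" "j \<in> insert i I" "z \<in> space (M j)" for x j z
    using insert.prems(2)[OF that] by (simp add: fun_upd_def)
  interpret Mi: prob_space "M i" by (rule M)
  interpret P: prob_space "PiM I M" by (intro prob_space_PiM M)
  interpret product_sigma_finite M
    using M by (simp add: product_sigma_finite_def prob_space_imp_sigma_finite)
  define g where "g x = (\<integral>y. f (x(i := y)) \<partial>M i)" for x
  have sp: "x(i := y) \<in> space (PiM (insert i I) M)"
    if "x \<in> space (PiM I M)" "y \<in> space (M i)" for x y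
    using that by (auto simp: space_PiM PiE_iff extensional_def)
  have g[measurable]: "g \<in> borel_measurable (PiM I M)"
    unfolding g_def by measurable
  have int_f: "integrable (PiM (insert i I) M) f"
    using insert.hyps(1) by (intro bounded_differences_integrable[OF _ M f bd]) simp_all
  have Eg: "integral\<^sup>L (PiM I M) g = integral\<^sup>L (PiM (insert i I) M) f"
    unfolding g_def using insert.hyps int_f by (simp add: product_integral_insert)
  have osc: "\<bar>f (x(i := y)) - f (x(i := z))\<bar> \<le> c i"
    if "x \<in> space (PiM I M)" "y \<in> space (M i)" "z \<in> space (M i)" for x y z
    using bd[OF sp[OF that(1,3)], of i y] that by simp
  have meas_sec[measurable]: "(\<lambda>y. f (x(i := y))) \<in> borel_measurable (M i)"
    if "x \<in> space (PiM I M)" for x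
    using that by measurable
  have int_sec: "integrable (M i) (\<lambda>y. f (x(i := y)))" if "x \<in> space (PiM I M)" for x
  proof -
    obtain z where z: "z \<in> space (M i)" using Mi.not_empty by auto
    have "norm (f (x(i := y))) \<le> \<bar>f (x(i := z))\<bar> + c i" if "y \<in> space (M i)" for y
      using osc[OF \<open>x \<in> _\<close> that z] by auto
    then show ?thesis
      using that by (intro Mi.integrable_const_bound[where B = "\<bar>f (x(i := z))\<bar> + c i"]) auto
  qed
  \<comment> \<open>Averaging over coordinate \<open>i\<close> does not enlarge the effect of
    another coordinate \<open>j\<close>.\<close>
  have bd_g: "\<bar>g (x(j := z)) - g x\<bar> \<le> c j"
    if x: "x \<in> space (PiM I M)" and j: "j \<in> I" and z: "z \<in> space (M j)" for x j z
  proof -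
    have x': "x(j := z) \<in> space (PiM I M)"
      using x j z by (auto simp: space_PiM PiE_iff extensional_def)
    have "j \<noteq> i" using j insert.hyps by auto
    have "\<bar>g (x(j := z)) - g x\<bar> = \<bar>\<integral>y. f (x(j := z, i := y)) - f (x(i := y)) \<partial>M i\<bar>"
      unfolding g_def using int_sec[OF x] int_sec[OF x'] by simp
    also have "\<dots> \<le> (\<integral>y. \<bar>f (x(j := z, i := y)) - f (x(i := y))\<bar> \<partial>M i)"
      by (rule integral_abs_bound)
    also have "\<dots> \<le> (\<integral>y. c j \<partial>M i)"
    proof (intro integral_mono)
      show "\<bar>f (x(j := z, i := y)) - f (x(i := y))\<bar> \<le> c j" if "y \<in> space (M i)" for y
        using bd[OF sp[OF x that], of j z] j z \<open>j \<noteq> i\<close> by (simp add: fun_upd_twist)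
    qed (use int_sec[OF x] int_sec[OF x'] in auto)
    finally show ?thesis by (simp add: Mi.prob_space)
  qed
  define E where "E = integral\<^sup>L (PiM (insert i I) M) f"
  have "(\<integral>\<^sup>+x. exp (s * (f x - E)) \<partial>PiM (insert i I) M)
      = (\<integral>\<^sup>+x. (\<integral>\<^sup>+y. exp (s * (f (x(i := y)) - E)) \<partial>M i) \<partial>PiM I M)"
    using insert.hyps by (subst product_nn_integral_insert) auto
  \<comment> \<open>The first factor is constant in \<open>y\<close>; the second is centred, because
    \<open>g x\<close> is the mean of the section at \<open>x\<close>.\<close>
  also have "\<dots> = (\<integral>\<^sup>+x. ennreal (exp (s * (g x - E))) *
      (\<integral>\<^sup>+y. exp (s * (f (x(i := y)) - g x)) \<partial>M i) \<partial>PiM I M)"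
    by (intro nn_integral_cong, subst nn_integral_cmult[symmetric])
       (auto simp flip: ennreal_mult exp_add simp: algebra_simps)
  also have "\<dots> \<le> (\<integral>\<^sup>+x. ennreal (exp (s * (g x - E))) * ennreal (exp (s\<^sup>2 * (c i)\<^sup>2 / 8)) \<partial>PiM I M)"
  proof (intro nn_integral_mono mult_left_mono)
    fix x assume x: "x \<in> space (PiM I M)"
    show "(\<integral>\<^sup>+y. exp (s * (f (x(i := y)) - g x)) \<partial>M i) \<le> ennreal (exp (s\<^sup>2 * (c i)\<^sup>2 / 8))"
      unfolding g_def using osc[OF x] x \<open>s > 0\<close>
      by (intro Hoeffdings_lemma_oscillation) (auto intro: M)
  qed auto
  also have "\<dots> = (\<integral>\<^sup>+x. ennreal (exp (s * (g x - E))) \<partial>PiM I M) * ennreal (exp (s\<^sup>2 * (c i)\<^sup>2 / 8))"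
    by (rule nn_integral_multc) auto
  also have "\<dots> \<le> ennreal (exp (s\<^sup>2 * (\<Sum>i\<in>I. (c i)\<^sup>2) / 8)) * ennreal (exp (s\<^sup>2 * (c i)\<^sup>2 / 8))"
    using insert.IH[OF g bd_g] unfolding Eg E_def by (intro mult_right_mono) auto
  also have "\<dots> = ennreal (exp (s\<^sup>2 * (\<Sum>i\<in>insert i I. (c i)\<^sup>2) / 8))"
    using insert.hyps
    by (simp flip: ennreal_mult exp_add add: algebra_simps add_divide_distrib)
  finally show ?case unfolding E_def .
qed

theorem McDiarmid_ineq_ge:
  fixes f :: "('i \<Rightarrow> 'a) \<Rightarrow> real"
  assumes "finite I" and M: "\<And>i. prob_space (M i)"
    and [measurable]: "f \<in> borel_measurable (PiM I M)"
    and bd: "\<And>x i z. x \<in> space (PiM I M) \<Longrightarrow> i \<in> I \<Longrightarrow> z \<in> space (M i) \<Longrightarrow>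
      \<bar>f (x(i := z)) - f x\<bar> \<le> c i"
    and "t \<ge> 0" and "(\<Sum>i\<in>I. (c i)\<^sup>2) > 0"
  shows "measure (PiM I M) {x \<in> space (PiM I M). f x \<ge> integral\<^sup>L (PiM I M) f + t}
    \<le> exp (- 2 * t\<^sup>2 / (\<Sum>i\<in>I. (c i)\<^sup>2))"
proof (cases "t = 0")
  \<comment> \<open>Here the Chernoff parameter chosen below would be 0, but the claimed bound is
    1.\<close>
  case True
  interpret prob_space "PiM I M" by (intro prob_space_PiM M)
  show ?thesis using True by simp
next
  case False
  interpret prob_space "PiM I M" by (intro prob_space_PiM M)
  define E where "E = integral\<^sup>L (PiM I M) f"
  define d where "d = (\<Sum>i\<in>I. (c i)\<^sup>2)"
  \<comment> \<open>The minimizer of the exponent \<open>s\<^sup>2 * d / 8 - s * t\<close>, with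
    minimum \<open>- 2 * t\<^sup>2 / d\<close>.\<close>
  define s where "s = 4 * t / d"
  have "d > 0" using assms(6) by (simp add: d_def)
  with False \<open>t \<ge> 0\<close> have "s > 0" by (simp add: s_def)
  have "emeasure (PiM I M) {x \<in> space (PiM I M). f x - E \<ge> t}
      \<le> ennreal (exp (- s * t)) * (\<integral>\<^sup>+x. exp (s * (f x - E)) \<partial>PiM I M)"
    using Chernoff_ineq_nn_integral_ge[OF \<open>s > 0\<close>, of "space (PiM I M)" "PiM I M" "\<lambda>x. f x - E" t]
    by (simp add: indicator_def cong: nn_integral_cong)
  also have "\<dots> \<le> ennreal (exp (- s * t)) * ennreal (exp (s\<^sup>2 * d / 8))"
    unfolding E_def d_def using assms \<open>s > 0\<close> by (intro mult_left_mono bounded_differences_mgf_le) auto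
  also have "\<dots> = ennreal (exp (- 2 * t\<^sup>2 / d))"
    using \<open>d > 0\<close>
    by (simp flip: ennreal_mult exp_add add: s_def field_simps power2_eq_square)
  finally show ?thesis
    unfolding emeasure_eq_measure E_def[symmetric] d_def[symmetric]
    by (simp add: algebra_simps)
qed

subsection \<open>Symmetrization\<close>

text \<open>Each coordinate of the mixture is read from exactly one of the two independent copies.
  Hence the preimage of a box is a product of two boxes, \<open>B1\<close> constraining the
  coordinates in \<open>A\<close> and \<open>B2\<close> the others, and the unconstrained
  coordinates contribute factors 1.\<close>

lemma distr_PiM_mix:
  assumes "finite I" and M: "\<And>i. prob_space (M i)"
  shows "distr (PiM I M \<Otimes>\<^sub>M PiM I M) (PiM I M) (\<lambda>(x, y). \<lambda>i\<in>I. if i \<in> A then x i else y i) = PiM I M"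
    (is "distr ?P _ ?mix = _")
proof -
  interpret P: prob_space "PiM I M" by (intro prob_space_PiM M)
  interpret product_sigma_finite M
    using M by (simp add: product_sigma_finite_def prob_space_imp_sigma_finite)
  show ?thesis
  proof (rule PiM_eqI)
    fix B assume B: "\<And>i. i \<in> I \<Longrightarrow> B i \<in> sets (M i)"
    define B1 where "B1 i = (if i \<in> A then B i else space (M i))" for i
    define B2 where "B2 i = (if i \<in> A then space (M i) else B i)" for i
    have B12: "B1 i \<in> sets (M i)" "B2 i \<in> sets (M i)" if "i \<in> I" for i
      using B[OF that] by (auto simp: B1_def B2_def)
    have [measurable]: "?mix \<in> measurable ?P (PiM I M)"
      unfolding case_prod_beta by (rule measurable_restrict) auto
    have "?mix -` Pi\<^sub>E I B \<inter> space ?P = Pi\<^sub>E I B1 \<times> Pi\<^sub>E I B2"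
      using B[THEN sets.sets_into_space]
      by (auto simp: space_pair_measure space_PiM B1_def B2_def PiE_iff split: if_splits) blast+
    then have "emeasure (distr ?P (PiM I M) ?mix) (Pi\<^sub>E I B)
        = emeasure ?P (Pi\<^sub>E I B1 \<times> Pi\<^sub>E I B2)"
      using B \<open>finite I\<close> by (subst emeasure_distr) (auto intro!: sets_PiM_I_finite)
    also have "\<dots> = (\<Prod>i\<in>I. emeasure (M i) (B1 i)) * (\<Prod>i\<in>I. emeasure (M i) (B2 i))"
      using B12 \<open>finite I\<close>
      by (subst P.emeasure_pair_measure_Times) (auto simp: emeasure_PiM intro!: sets_PiM_I_finite)
    also have "\<dots> = (\<Prod>i\<in>I. emeasure (M i) (B i))"
      unfolding prod.distrib[symmetric]
      by (intro prod.cong) (auto simp: B1_def B2_def prob_space.emeasure_space_1[OF M])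
    finally show "emeasure (distr ?P (PiM I M) ?mix) (Pi\<^sub>E I B) = (\<Prod>i\<in>I. emeasure (M i) (B i))" .
  qed (use assms in auto)
qed

section \<open>Oscillation of signed means\<close>

text \<open>Since the supremum at \<open>- \<epsilon>\<close> is minus the infimum at
  \<open>\<epsilon>\<close>, this is supremum minus infimum. Writing it with \<open>rad_sup\<close>
  lets integrability and expectation pass directly from \<open>rad_sup\<close>; the next two lemmas
  recover the supremum over pairs.\<close>

definition rad_osc :: "'h set \<Rightarrow> ('h \<Rightarrow> 'z \<Rightarrow> real) \<Rightarrow> nat \<Rightarrow> (nat \<Rightarrow> real) \<Rightarrow> (nat \<Rightarrow> 'z) \<Rightarrow> real" where
  "rad_osc H loss m \<epsilon> S = rad_sup H loss m S \<epsilon> + rad_sup H loss m S (\<lambda>i. - \<epsilon> i)"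

text \<open>Take the supremum over \<open>h\<close> with \<open>h'\<close> fixed, then over
  \<open>h'\<close>.\<close>

lemma rad_osc_le:
  assumes "H \<noteq> {}"
    and le: "\<And>h h'. h \<in> H \<Longrightarrow> h' \<in> H \<Longrightarrow>
      (1 / real m) * (\<Sum>i<m. \<epsilon> i * (loss h (S i) - loss h' (S i))) \<le> B"
  shows "rad_osc H loss m \<epsilon> S \<le> B"
proof -
  define a where "a h = (1 / real m) * (\<Sum>i<m. \<epsilon> i * loss h (S i))" for h
  have a: "a h - a h' \<le> B" if "h \<in> H" "h' \<in> H" for h h'
    using le[OF that] by (simp add: a_def right_diff_distrib sum_subtractf)
  have "Sup (a ` H) \<le> B + a h'" if "h' \<in> H" for h'
    using assms(1) a[OF _ that] by (intro cSUP_least) (auto simp: algebra_simps)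
  then have "(SUP h'\<in>H. - a h') \<le> B - Sup (a ` H)"
    using assms(1) by (intro cSUP_least) (auto simp: algebra_simps)
  then show ?thesis
    by (simp add: rad_osc_def rad_sup_def a_def sum_negf)
qed

lemma abs_sign_mean_le_rad_osc:
  assumes bd: "\<And>h h' i. h \<in> H \<Longrightarrow> h' \<in> H \<Longrightarrow> i < m \<Longrightarrow> \<bar>loss h (S i) - loss h' (S i)\<bar> \<le> L"
    and h: "h \<in> H" and h': "h' \<in> H"
  shows "\<bar>(1 / real m) * (\<Sum>i<m. \<epsilon> i * (loss h (S i) - loss h' (S i)))\<bar> \<le> rad_osc H loss m \<epsilon> S"
proof -
  \<comment> \<open>A real supremum is informative only for a bounded family. The losses themselves
    carry no bound, but every signed mean stays within a fixed distance of the one at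
    \<open>h\<close>.\<close>
  have bdd: "bdd_above ((\<lambda>h. (1 / real m) * (\<Sum>i<m. \<epsilon> i * loss h (S i))) ` H)" for \<epsilon>
  proof (rule bdd_aboveI2)
    fix g assume g: "g \<in> H"
    have "(\<Sum>i<m. \<epsilon> i * loss g (S i)) \<le> (\<Sum>i<m. \<epsilon> i * loss h (S i) + \<bar>\<epsilon> i\<bar> * L)"
    proof (rule sum_mono)
      fix i assume "i \<in> {..<m}"
      then have "\<bar>\<epsilon> i\<bar> * \<bar>loss g (S i) - loss h (S i)\<bar> \<le> \<bar>\<epsilon> i\<bar> * L"
        using bd[OF g h] by (intro mult_left_mono) auto
      then have "\<bar>\<epsilon> i * (loss g (S i) - loss h (S i))\<bar> \<le> \<bar>\<epsilon> i\<bar> * L"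
        by (simp add: abs_mult)
      then show "\<epsilon> i * loss g (S i) \<le> \<epsilon> i * loss h (S i) + \<bar>\<epsilon> i\<bar> * L"
        by (simp add: abs_le_iff algebra_simps)
    qed
    then show "(1 / real m) * (\<Sum>i<m. \<epsilon> i * loss g (S i))
        \<le> (1 / real m) * (\<Sum>i<m. \<epsilon> i * loss h (S i) + \<bar>\<epsilon> i\<bar> * L)"
      by (intro mult_left_mono) auto
  qed
  have "(1 / real m) * (\<Sum>i<m. \<epsilon> i * (loss g (S i) - loss g' (S i))) \<le> rad_osc H loss m \<epsilon> S"
    if "g \<in> H" "g' \<in> H" for g g'
    using cSUP_upper[OF that(1) bdd[of \<epsilon>]] cSUP_upper[OF that(2) bdd[of "\<lambda>i. - \<epsilon> i"]]
    by (simp add: rad_osc_def rad_sup_def right_diff_distrib sum_subtractf sum_negf)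
  from this[OF h h'] this[OF h' h] show ?thesis
    by (simp add: abs_le_iff right_diff_distrib sum_subtractf)
qed

section \<open>Choice of a sign vector\<close>

lemma rad_sup_cong:
  assumes "\<And>i. i < m \<Longrightarrow> \<epsilon> i = \<epsilon>' i"
  shows "rad_sup H loss m S \<epsilon> = rad_sup H loss m S \<epsilon>'"
  using assms by (simp add: rad_sup_def)

lemma prob_space_rademacher_measure: "prob_space (rademacher_measure m)"
  unfolding rademacher_measure_def by (intro prob_space_PiM prob_space_measure_pmf)

text \<open>Negation permutes the two signs, so it preserves each factor. \<open>compose\<close>
  keeps the negated vector extensional, hence inside the product space.\<close>

lemma distr_rademacher_measure_uminus:
  "distr (rademacher_measure m) (rademacher_measure m) (compose {..<m} uminus) = rademacher_measure m"
proof -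
  let ?p = "pmf_of_set {-1::real, 1}"
  have "map_pmf uminus ?p = pmf_of_set (uminus ` {-1::real, 1})"
    by (intro map_pmf_of_set_inj) auto
  also have "uminus ` {-1::real, 1} = {-1, 1}" by auto
  finally have "distr (measure_pmf ?p) (measure_pmf ?p) uminus = measure_pmf ?p"
    by (metis (no_types) distr_cong map_pmf_rep_eq sets_measure_pmf_count_space sets_measure_pmf)
  then show ?thesis
    unfolding rademacher_measure_def
    by (subst distr_PiM_finite_prob_space') (auto intro: prob_space_measure_pmf)
qed

lemma AE_rademacher_measure_signs:
  "AE \<epsilon> in rademacher_measure m. \<forall>i<m. \<epsilon> i = -1 \<or> \<epsilon> i = 1"
proof -
  have "AE \<epsilon> in rademacher_measure m. \<forall>i\<in>{..<m}. \<epsilon> i \<in> {-1, 1}"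
    unfolding rademacher_measure_def
    by (intro AE_finite_allI AE_PiM_component prob_space_measure_pmf) (auto simp: AE_measure_pmf_iff)
  then show ?thesis by eventually_elim auto
qed

text \<open>First-moment argument: a random sign vector and its negation have the same law, so the
  expected oscillation averages to twice the complexity, and some vector does no worse than average.
  It can be picked among those with integrable sections, which are almost all.\<close>

lemma exists_signs_integral_rad_osc_le:
  assumes "prob_space D"
    and int: "integrable (sample_measure D m \<Otimes>\<^sub>M rademacher_measure m)
      (\<lambda>(S, \<epsilon>). rad_sup H loss m S \<epsilon>)"
  obtains \<epsilon> where "\<And>i. i < m \<Longrightarrow> \<epsilon> i = -1 \<or> \<epsilon> i = 1"
    and "integrable (sample_measure D m) (rad_osc H loss m \<epsilon>)"
    and "integral\<^sup>L (sample_measure D m) (rad_osc H loss m \<epsilon>) \<le> 2 * rademacher_complexity D H loss m"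
proof -
  let ?P = "sample_measure D m" and ?N = "rademacher_measure m" and ?neg = "compose {..<m} uminus"
  define q where "q \<epsilon> = (\<integral>S. rad_sup H loss m S \<epsilon> \<partial>?P)" for \<epsilon>
  define R where "R = rademacher_complexity D H loss m"
  interpret P: prob_space ?P
    unfolding sample_measure_def by (intro prob_space_PiM assms)
  interpret N: prob_space ?N by (rule prob_space_rademacher_measure)
  interpret pair_sigma_finite ?P ?N ..
  have neg[measurable]: "?neg \<in> measurable ?N ?N"
    unfolding rademacher_measure_def compose_def
    by (rule measurable_restrict, rule measurable_compose[OF measurable_component_singleton]) auto
  have int_sec: "AE \<epsilon> in ?N. integrable ?P (\<lambda>S. rad_sup H loss m S \<epsilon>)"
    by (rule AE_integrable_snd[OF int])
  then have int_sec_neg: "AE \<epsilon> in ?N. integrable ?P (\<lambda>S. rad_sup H loss m S (?neg \<epsilon>))"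
    by (intro AE_distrD[OF neg]) (simp only: distr_rademacher_measure_uminus)
  have int_q: "integrable ?N q"
    unfolding q_def by (rule integrable_snd[OF int])
  \<comment> \<open>\<open>q\<close> averages over the sample first, whereas the complexity averages
    over the signs first.\<close>
  have q: "integral\<^sup>L ?N q = R"
    unfolding q_def R_def rademacher_complexity_def by (rule Fubini_integral[OF int])
  have int_q_neg: "integrable ?N (\<lambda>\<epsilon>. q (?neg \<epsilon>))"
    using int_q by (intro integrable_distr[OF neg]) (simp add: distr_rademacher_measure_uminus)
  have q_neg: "(\<integral>\<epsilon>. q (?neg \<epsilon>) \<partial>?N) = R"
    using integral_distr[OF neg borel_measurable_integrable[OF int_q]] q
    by (simp add: distr_rademacher_measure_uminus)
  define Good where "Good \<epsilon> \<longleftrightarrow> (\<forall>i<m. \<epsilon> i = -1 \<or> \<epsilon> i = 1) \<and>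
      integrable ?P (\<lambda>S. rad_sup H loss m S \<epsilon>) \<and>
      integrable ?P (\<lambda>S. rad_sup H loss m S (?neg \<epsilon>))" for \<epsilon>
  have Good: "AE \<epsilon> in ?N. Good \<epsilon>"
    using AE_rademacher_measure_signs[of m] int_sec int_sec_neg
    by eventually_elim (simp add: Good_def)
  have "\<exists>\<epsilon>. Good \<epsilon> \<and> q \<epsilon> + q (?neg \<epsilon>) \<le> 2 * R"
  \<comment> \<open>Otherwise \<open>2 * R < q \<epsilon> + q (?neg \<epsilon>)\<close> almost
    everywhere, and integrating would give \<open>2 * R < 2 * R\<close>.\<close>
  proof (rule ccontr)
    assume "\<not> ?thesis"
    with Good have "AE \<epsilon> in ?N. 2 * R < q \<epsilon> + q (?neg \<epsilon>)"
      by (auto elim!: eventually_mono simp: not_le)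
    then have "(\<integral>\<epsilon>. 2 * R \<partial>?N) < (\<integral>\<epsilon>. q \<epsilon> + q (?neg \<epsilon>) \<partial>?N)"
      using int_q int_q_neg by (intro N.integral_less_AE_space) (auto simp: N.emeasure_space_1)
    then show False
      using int_q int_q_neg q q_neg by (simp add: N.prob_space)
  qed
  then obtain \<epsilon> where \<epsilon>: "Good \<epsilon>" "q \<epsilon> + q (?neg \<epsilon>) \<le> 2 * R" by blast
  \<comment> \<open>\<open>?neg \<epsilon>\<close> is the pointwise negation only on indices below
    \<open>m\<close>, which are all that \<open>rad_sup\<close> reads.\<close>
  have osc: "rad_osc H loss m \<epsilon> = (\<lambda>S. rad_sup H loss m S \<epsilon> + rad_sup H loss m S (?neg \<epsilon>))"
    by (rule ext) (auto simp: rad_osc_def compose_def intro!: rad_sup_cong)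
  show thesis
  proof (rule that)
    show "\<epsilon> i = -1 \<or> \<epsilon> i = 1" if "i < m" for i
      using \<epsilon>(1) that by (simp add: Good_def)
    show "integrable ?P (rad_osc H loss m \<epsilon>)"
      using \<epsilon>(1) by (simp add: osc Good_def)
    show "integral\<^sup>L ?P (rad_osc H loss m \<epsilon>) \<le> 2 * rademacher_complexity D H loss m"
      using \<epsilon> by (simp add: osc Good_def q_def R_def)
  qed
qed

section \<open>The measurable majorant of the gap differences\<close>

text \<open>The losses are controlled in \<open>h\<close> but not in \<open>z\<close>, so a single
  Rademacher supremum need not have bounded differences. In the oscillation only loss differences
  occur: one summand changes, between two values of size at most \<open>L\<close>.\<close>

lemma rad_osc_bounded_difference:
  assumes "H \<noteq> {}" and "i < m"
    and bd: "\<And>h h' z. h \<in> H \<Longrightarrow> h' \<in> H \<Longrightarrow> z \<in> \<Omega> \<Longrightarrow> \<bar>loss h z - loss h' z\<bar> \<le> L"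
    and sgn: "\<And>i. i < m \<Longrightarrow> \<bar>\<epsilon> i\<bar> \<le> 1"
    and S: "\<And>j. j < m \<Longrightarrow> S j \<in> \<Omega>" and S': "\<And>j. j < m \<Longrightarrow> S' j \<in> \<Omega>"
    and eq: "\<And>j. j < m \<Longrightarrow> j \<noteq> i \<Longrightarrow> S' j = S j"
  shows "\<bar>rad_osc H loss m \<epsilon> S' - rad_osc H loss m \<epsilon> S\<bar> \<le> 2 * L / real m"
proof -
  have one_sided: "rad_osc H loss m \<epsilon> U \<le> rad_osc H loss m \<epsilon> V + 2 * L / real m"
    if U: "\<And>j. j < m \<Longrightarrow> U j \<in> \<Omega>" and V: "\<And>j. j < m \<Longrightarrow> V j \<in> \<Omega>"
      and UV: "\<And>j. j < m \<Longrightarrow> j \<noteq> i \<Longrightarrow> U j = V j" for U V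
  proof (rule rad_osc_le[OF \<open>H \<noteq> {}\<close>])
    fix h h' assume h: "h \<in> H" "h' \<in> H"
    define a where "a z = loss h z - loss h' z" for z
    have L: "\<bar>a (U i)\<bar> \<le> L" "\<bar>a (V i)\<bar> \<le> L"
      using bd h U V \<open>i < m\<close> by (auto simp: a_def)
    have "(\<Sum>j<m. \<epsilon> j * a (U j)) - (\<Sum>j<m. \<epsilon> j * a (V j)) = (\<Sum>j<m. \<epsilon> j * (a (U j) - a (V j)))"
      by (simp add: right_diff_distrib sum_subtractf)
    also have "\<dots> = (\<Sum>j\<in>{i}. \<epsilon> j * (a (U j) - a (V j)))"
      using \<open>i < m\<close> UV by (intro sum.mono_neutral_right) auto
    also have "\<dots> \<le> \<bar>\<epsilon> i\<bar> * \<bar>a (U i) - a (V i)\<bar>"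
      by (simp flip: abs_mult)
    also have "\<dots> \<le> 1 * (2 * L)"
      using sgn[OF \<open>i < m\<close>] L by (intro mult_mono) auto
    finally have "(1 / real m) * (\<Sum>j<m. \<epsilon> j * a (U j))
        \<le> (1 / real m) * ((\<Sum>j<m. \<epsilon> j * a (V j)) + 2 * L)"
      by (intro mult_left_mono) auto
    also have "\<dots> = (1 / real m) * (\<Sum>j<m. \<epsilon> j * a (V j)) + 2 * L / real m"
      by (simp add: algebra_simps add_divide_distrib)
    also have "(1 / real m) * (\<Sum>j<m. \<epsilon> j * a (V j)) \<le> rad_osc H loss m \<epsilon> V"
      unfolding a_def using bd V h
      by (intro order_trans[OF abs_ge_self abs_sign_mean_le_rad_osc[where L = L]]) auto
    finally show "(1 / real m) * (\<Sum>j<m. \<epsilon> j * (loss h (U j) - loss h' (U j)))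
        \<le> rad_osc H loss m \<epsilon> V + 2 * L / real m"
      by (simp add: a_def)
  qed
  show ?thesis
    using one_sided[of S' S] one_sided[of S S'] S S' eq by (simp add: abs_le_iff)
qed

lemma exists_gen_gap_majorant:
  fixes D :: "'z measure" and H :: "'h set" and loss :: "'h \<Rightarrow> 'z \<Rightarrow> real"
  assumes "prob_space D" and "m > 0" and "H \<noteq> {}"
    and int_loss: "\<And>h. h \<in> H \<Longrightarrow> integrable D (loss h)"
    and bd: "\<And>h h' z. h \<in> H \<Longrightarrow> h' \<in> H \<Longrightarrow> z \<in> space D \<Longrightarrow> \<bar>loss h z - loss h' z\<bar> \<le> L"
    and int: "integrable (sample_measure D m \<Otimes>\<^sub>M rademacher_measure m)
      (\<lambda>(S, \<epsilon>). rad_sup H loss m S \<epsilon>)"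
  obtains W where "W \<in> borel_measurable (sample_measure D m)"
    and "\<And>S i z. S \<in> space (sample_measure D m) \<Longrightarrow> i < m \<Longrightarrow> z \<in> space D \<Longrightarrow>
      \<bar>W (S(i := z)) - W S\<bar> \<le> 2 * L / real m"
    and "integral\<^sup>L (sample_measure D m) W \<le> 4 * rademacher_complexity D H loss m"
    and "\<And>S h h'. S \<in> space (sample_measure D m) \<Longrightarrow> h \<in> H \<Longrightarrow> h' \<in> H \<Longrightarrow>
      \<bar>gen_gap D loss m S h - gen_gap D loss m S h'\<bar> \<le> W S"
proof -
  let ?P = "sample_measure D m"
  interpret D: prob_space D by fact
  interpret P: prob_space ?P
    unfolding sample_measure_def by (intro prob_space_PiM assms)
  interpret PP: pair_prob_space ?P ?P ..
  have space_P: "S \<in> space ?P \<longleftrightarrow> S \<in> Pi\<^sub>E {..<m} (\<lambda>_. space D)" for S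
    by (simp add: sample_measure_def space_PiM)
  have comp: "S i \<in> space D" if "S \<in> space ?P" "i < m" for S i
    using that by (auto simp: space_P)

  obtain \<epsilon> where sgn: "\<And>i. i < m \<Longrightarrow> \<epsilon> i = -1 \<or> \<epsilon> i = (1::real)"
    and int_osc: "integrable ?P (rad_osc H loss m \<epsilon>)"
    and osc_le: "integral\<^sup>L ?P (rad_osc H loss m \<epsilon>) \<le> 2 * rademacher_complexity D H loss m"
    using exists_signs_integral_rad_osc_le[OF \<open>prob_space D\<close> int] by metis
  define \<rho> where "\<rho> = rad_osc H loss m \<epsilon>"
  note \<rho>[measurable] = borel_measurable_integrable[OF int_osc, folded \<rho>_def]
  have sgn': "\<bar>\<epsilon> i\<bar> \<le> 1" if "i < m" for i
    using sgn[OF that] by auto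
  have \<rho>_ge: "\<bar>(1 / real m) * (\<Sum>i<m. \<epsilon> i * (loss h (S i) - loss h' (S i)))\<bar> \<le> \<rho> S"
    if "S \<in> space ?P" "h \<in> H" "h' \<in> H" for S h h'
    unfolding \<rho>_def using that comp bd by (intro abs_sign_mean_le_rad_osc[where L = L]) auto

  define mix where "mix A = (\<lambda>(X, Y). \<lambda>i\<in>{..<m}. if i \<in> A then X i else (Y i :: 'z))" for A
  have mix[measurable]: "mix A \<in> measurable (?P \<Otimes>\<^sub>M ?P) ?P" for A
    unfolding mix_def case_prod_beta sample_measure_def by (rule measurable_restrict) auto
  have mix_space: "mix A (X, Y) \<in> space ?P" if "X \<in> space ?P" "Y \<in> space ?P" for A X Y
    using measurable_space[OF mix] that by (simp add: space_pair_measure)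
  have distr_mix: "distr (?P \<Otimes>\<^sub>M ?P) ?P (mix A) = ?P" for A
    unfolding mix_def sample_measure_def
    by (intro distr_PiM_mix \<open>prob_space D\<close>) auto
  have int_mix: "integrable (?P \<Otimes>\<^sub>M ?P) (\<lambda>p. \<rho> (mix A p))" for A
    using int_osc by (intro integrable_distr[OF mix]) (simp add: distr_mix \<rho>_def)
  have integral_mix: "(\<integral>p. \<rho> (mix A p) \<partial>(?P \<Otimes>\<^sub>M ?P)) = integral\<^sup>L ?P \<rho>" for A
    using integral_distr[OF mix \<rho>, of A] by (simp add: distr_mix)

  define A where "A = {i. \<epsilon> i = 1}"
  define V where "V p = \<rho> (mix A p) + \<rho> (mix (- A) p)" for p
  define W where "W X = (\<integral>Y. V (X, Y) \<partial>?P)" for X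
  have V[measurable]: "V \<in> borel_measurable (?P \<Otimes>\<^sub>M ?P)"
    unfolding V_def by measurable
  have int_V: "integrable (?P \<Otimes>\<^sub>M ?P) V"
    unfolding V_def by (intro Bochner_Integration.integrable_add int_mix)

  \<comment> \<open>Boundedness makes every section of \<open>V\<close> integrable, not merely
    almost every one; \<open>W\<close> is compared at arbitrary points below.\<close>
  have \<rho>_bound: "\<bar>\<rho> S\<bar> \<le> L" if S: "S \<in> space ?P" for S
  proof -
    have "\<rho> S \<le> L"
      unfolding \<rho>_def
    proof (rule rad_osc_le[OF \<open>H \<noteq> {}\<close>])
      fix h h' assume h: "h \<in> H" "h' \<in> H"
      have "(\<Sum>i<m. \<epsilon> i * (loss h (S i) - loss h' (S i))) \<le> (\<Sum>i<m. L)"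
      proof (rule sum_mono)
        fix i assume "i \<in> {..<m}"
        then show "\<epsilon> i * (loss h (S i) - loss h' (S i)) \<le> L"
          using sgn[of i] bd[OF h comp[OF S]] by (auto simp: abs_le_iff)
      qed
      then show "(1 / real m) * (\<Sum>i<m. \<epsilon> i * (loss h (S i) - loss h' (S i))) \<le> L"
        using \<open>m > 0\<close> by (simp add: field_simps)
    qed
    moreover have "0 \<le> \<rho> S"
      using \<rho>_ge[OF S] \<open>H \<noteq> {}\<close> abs_ge_zero order_trans by blast
    ultimately show ?thesis by simp
  qed
  have int_sec: "integrable ?P (\<lambda>Y. V (X, Y))" if X: "X \<in> space ?P" for X
  proof (rule P.integrable_const_bound[where B = "2 * L"])
    show "AE Y in ?P. norm (V (X, Y)) \<le> 2 * L"
    proof (rule AE_I2)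
      fix Y assume "Y \<in> space ?P"
      with X show "norm (V (X, Y)) \<le> 2 * L"
        using \<rho>_bound[OF mix_space, of X Y A] \<rho>_bound[OF mix_space, of X Y "- A"]
        by (simp add: V_def)
    qed
    show "(\<lambda>Y. V (X, Y)) \<in> borel_measurable ?P"
      using X by measurable
  qed

  have W_meas: "W \<in> borel_measurable ?P"
    unfolding W_def by measurable

  have W_diff: "\<bar>W (X(i := z)) - W X\<bar> \<le> 2 * L / real m"
    if X: "X \<in> space ?P" and i: "i < m" and z: "z \<in> space D" for X i z
  proof -
    have X': "X(i := z) \<in> space ?P"
      using X i z by (auto simp: space_P PiE_iff extensional_def)
    txt \<open>Changing \<open>X i\<close> affects only one of the two complementary mixtures.\<close>
    have V_diff: "\<bar>V (X(i := z), Y) - V (X, Y)\<bar> \<le> 2 * L / real m" if Y: "Y \<in> space ?P" for Y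
    proof -
      have same: "mix B (X(i := z), Y) = mix B (X, Y)" if "i \<notin> B" for B
        using that by (auto simp: mix_def restrict_def)
      have diff: "\<bar>\<rho> (mix B (X(i := z), Y)) - \<rho> (mix B (X, Y))\<bar> \<le> 2 * L / real m" for B
        unfolding \<rho>_def
      proof (rule rad_osc_bounded_difference[where \<Omega> = "space D", OF \<open>H \<noteq> {}\<close> i bd sgn'])
        show "mix B (X, Y) j \<in> space D" if "j < m" for j
          by (rule comp[OF mix_space[OF X Y] that])
        show "mix B (X(i := z), Y) j \<in> space D" if "j < m" for j
          by (rule comp[OF mix_space[OF X' Y] that])
        show "mix B (X(i := z), Y) j = mix B (X, Y) j" if "j < m" "j \<noteq> i" for j
          using that by (simp add: mix_def)
      qed
      show ?thesis
        using diff[of A] diff[of "- A"] same[of A] same[of "- A"]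
        by (cases "i \<in> A") (auto simp: V_def)
    qed
    have "\<bar>W (X(i := z)) - W X\<bar> = \<bar>\<integral>Y. V (X(i := z), Y) - V (X, Y) \<partial>?P\<bar>"
      unfolding W_def using int_sec[OF X] int_sec[OF X'] by simp
    also have "\<dots> \<le> (\<integral>Y. \<bar>V (X(i := z), Y) - V (X, Y)\<bar> \<partial>?P)"
      by (rule integral_abs_bound)
    also have "\<dots> \<le> (\<integral>Y. 2 * L / real m \<partial>?P)"
      using int_sec[OF X] int_sec[OF X'] V_diff by (intro integral_mono) auto
    finally show ?thesis by (simp add: P.prob_space)
  qed

  have "integral\<^sup>L ?P W = integral\<^sup>L (?P \<Otimes>\<^sub>M ?P) V"
    unfolding W_def by (rule PP.integral_fst'[OF int_V])
  \<comment> \<open>Both mixtures have the law of one sample. With the factor 2 from the choice of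
    signs this yields the constant 4.\<close>
  also have "\<dots> = 2 * integral\<^sup>L ?P \<rho>"
    unfolding V_def by (simp add: int_mix integral_mix)
  finally have EW: "integral\<^sup>L ?P W \<le> 4 * rademacher_complexity D H loss m"
    using osc_le by (simp add: \<rho>_def)

  have dom: "\<bar>gen_gap D loss m X h - gen_gap D loss m X h'\<bar> \<le> W X"
    if X: "X \<in> space ?P" and h: "h \<in> H" "h' \<in> H" for X h h'
  proof -
    define d where "d z = loss h z - loss h' z" for z
    have int_d: "integrable D d"
      unfolding d_def using int_loss h by auto
    have coord[measurable]: "(\<lambda>Y. Y i) \<in> measurable ?P D" if "i < m" for i
      using that unfolding sample_measure_def by (intro measurable_component_singleton) auto
    have distr_coord: "distr ?P D (\<lambda>Y. Y i) = D" if "i < m" for i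
      using that unfolding sample_measure_def
      by (intro distr_PiM_component[where M = "\<lambda>_. D"] \<open>prob_space D\<close>) auto
    have int_coord: "integrable ?P (\<lambda>Y. d (Y i))" if "i < m" for i
      using int_d that by (intro integrable_distr[OF coord]) (simp_all add: distr_coord)
    have integral_coord: "(\<integral>Y. d (Y i) \<partial>?P) = integral\<^sup>L D d" if "i < m" for i
      using integral_distr[OF coord[OF that] borel_measurable_integrable[OF int_d]] that
      by (simp add: distr_coord)
    \<comment> \<open>The ghost sample replaces the true risk: the mean of \<open>G\<close> is the
      difference of the two signed generalization gaps.\<close>
    define G where "G Y = (1 / real m) * (\<Sum>i<m. d (Y i) - d (X i))" for Y
    have int_G: "integrable ?P G"
      unfolding G_def using int_coord by (auto intro!: Bochner_Integration.integrable_sum)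
    have "integral\<^sup>L ?P G = (1 / real m) * (\<Sum>i<m. integral\<^sup>L D d - d (X i))"
      unfolding G_def using int_coord
      by (subst integral_mult_right_zero, subst Bochner_Integration.integral_sum)
         (auto simp: integral_coord P.prob_space intro!: sum.cong)
    also have "\<dots> = integral\<^sup>L D d - (1 / real m) * (\<Sum>i<m. d (X i))"
      using \<open>m > 0\<close> by (simp add: sum_subtractf field_simps)
    also have "\<dots> = (true_risk D loss h - emp_risk loss m X h) - (true_risk D loss h' - emp_risk loss m X h')"
      unfolding d_def using int_loss h
      by (simp add: true_risk_def emp_risk_def sum_subtractf right_diff_distrib)
    \<comment> \<open>Reverse triangle inequality, as \<open>gen_gap\<close> is an absolute
      value.\<close>
    finally have "\<bar>gen_gap D loss m X h - gen_gap D loss m X h'\<bar> \<le> \<bar>integral\<^sup>L ?P G\<bar>"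
      unfolding gen_gap_def by linarith
    also have "\<dots> \<le> (\<integral>Y. \<bar>G Y\<bar> \<partial>?P)"
      by (rule integral_abs_bound)
    also have "\<dots> \<le> W X"
      unfolding W_def
    proof (intro integral_mono)
      fix Y assume Y: "Y \<in> space ?P"
      \<comment> \<open>Where the sign is 1, the mixtures over \<open>- A\<close> and
        \<open>A\<close> read \<open>Y\<close> and \<open>X\<close>; where it is -1 these roles swap
        and the sign undoes the swap.\<close>
      have "(\<Sum>i<m. d (Y i) - d (X i))
          = (\<Sum>i<m. \<epsilon> i * d (mix (- A) (X, Y) i) - \<epsilon> i * d (mix A (X, Y) i))"
        using sgn by (intro sum.cong) (fastforce simp: mix_def A_def)+
      then have "G Y = (1 / real m) * (\<Sum>i<m. \<epsilon> i * d (mix (- A) (X, Y) i))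
          - (1 / real m) * (\<Sum>i<m. \<epsilon> i * d (mix A (X, Y) i))"
        by (simp add: G_def sum_subtractf right_diff_distrib)
      then show "\<bar>G Y\<bar> \<le> V (X, Y)"
        using \<rho>_ge[OF mix_space[OF X Y] h, of A] \<rho>_ge[OF mix_space[OF X Y] h, of "- A"]
        unfolding V_def d_def by linarith
    qed (use int_G int_sec[OF X] in auto)
    finally show ?thesis .
  qed

  show thesis
    by (rule that[OF W_meas W_diff EW dom])
qed

section \<open>Concentration of the majorant and the Lipschitz bound\<close>

theorem theorem5p1:
  fixes D :: "'z measure" and H :: "'h set" and loss :: "'h \<Rightarrow> 'z \<Rightarrow> real"
    and L :: real and m :: nat and \<delta> :: real
  assumes "prob_space D"
    and "m > 0"
    and "\<delta> > 0" and "\<delta> < 1"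
    and "\<And>h. h \<in> H \<Longrightarrow> integrable D (loss h)"
    and "\<And>h h' z. h \<in> H \<Longrightarrow> h' \<in> H \<Longrightarrow> z \<in> space D \<Longrightarrow>
           \<bar>loss h z - loss h' z\<bar> \<le> L * d_kron h h'"
    and "integrable (sample_measure D m \<Otimes>\<^sub>M rademacher_measure m)
           (\<lambda>(S, \<epsilon>). rad_sup H loss m S \<epsilon>)"
  shows "\<exists>E \<in> sets (sample_measure D m).
           measure (sample_measure D m) E \<ge> 1 - \<delta> \<and>
           (\<forall>S\<in>E. \<forall>h\<in>H. \<forall>h'\<in>H.
              \<bar>gen_gap D loss m S h - gen_gap D loss m S h'\<bar>
                \<le> (4 * rademacher_complexity D H loss m
                    + L * sqrt (2 * ln (2 / \<delta>) / real m)) * d_kron h h')"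
proof -
  let ?P = "sample_measure D m"
  interpret D: prob_space D by fact
  interpret P: prob_space ?P
    unfolding sample_measure_def by (intro prob_space_PiM assms)
  show ?thesis
  proof (cases "\<exists>h\<in>H. \<exists>h'\<in>H. h \<noteq> h'")
    \<comment> \<open>With at most one hypothesis only diagonal pairs occur and both sides vanish.
      The case is separate because \<open>L\<close> may be negative here.\<close>
    case False
    then have "\<bar>gen_gap D loss m S h - gen_gap D loss m S h'\<bar> \<le> c * d_kron h h'"
      if "h \<in> H" "h' \<in> H" for S h h' c
      using that by (auto simp: d_kron_def)
    then show ?thesis
      using \<open>\<delta> > 0\<close> by (intro bexI[where x = "space ?P"]) (auto simp: P.prob_space)
  next
    case True
    then obtain h0 h1 where h01: "h0 \<in> H" "h1 \<in> H" "h0 \<noteq> h1" by blast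
    obtain z0 where "z0 \<in> space D" using D.not_empty by blast
    with assms(6)[OF h01(1,2)] h01(3) have "L \<ge> 0"
      by (fastforce simp: d_kron_def)
    have bd: "\<bar>loss h z - loss h' z\<bar> \<le> L" if "h \<in> H" "h' \<in> H" "z \<in> space D" for h h' z
      using assms(6)[OF that] \<open>L \<ge> 0\<close> by (auto simp: d_kron_def split: if_splits)
    obtain W where W[measurable]: "W \<in> borel_measurable ?P"
      and W_diff: "\<And>S i z. S \<in> space ?P \<Longrightarrow> i < m \<Longrightarrow> z \<in> space D \<Longrightarrow>
        \<bar>W (S(i := z)) - W S\<bar> \<le> 2 * L / real m"
      and EW: "integral\<^sup>L ?P W \<le> 4 * rademacher_complexity D H loss m"
      and dom: "\<And>S h h'. S \<in> space ?P \<Longrightarrow> h \<in> H \<Longrightarrow> h' \<in> H \<Longrightarrow>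
        \<bar>gen_gap D loss m S h - gen_gap D loss m S h'\<bar> \<le> W S"
      using exists_gen_gap_majorant[OF assms(1,2) _ assms(5) bd assms(7)] h01(1) by blast
    define t where "t = L * sqrt (2 * ln (2 / \<delta>) / real m)"
    have ln_pos: "ln (2 / \<delta>) > 0"
      using assms(3,4) by simp
    have "t \<ge> 0"
      using \<open>L \<ge> 0\<close> ln_pos by (simp add: t_def)
    \<comment> \<open>The strict inequality matters when \<open>L = 0\<close>: then
      \<open>t = 0\<close>, and \<open>Bad\<close> has to be empty.\<close>
    define Bad where "Bad = {S \<in> space ?P. W S > integral\<^sup>L ?P W + t}"
    have [measurable]: "Bad \<in> sets ?P"
      unfolding Bad_def by measurable
    have "measure ?P Bad \<le> \<delta>"
    proof (cases "L = 0")
      \<comment> \<open>McDiarmid's inequality needs a positive sum of squares. Here all differences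
        vanish, so \<open>W\<close> is constant and equals its mean.\<close>
      case True
      have const: "W S = W S'" if "S \<in> space ?P" "S' \<in> space ?P" for S S'
      proof -
        have "\<bar>W S - W S'\<bar> \<le> (\<Sum>i<m. 2 * L / real m)"
        proof (rule bounded_differences_imp_diff_le_sum[where S = "\<lambda>_. space D"])
          show "S \<in> {..<m} \<rightarrow>\<^sub>E space D" "S' \<in> {..<m} \<rightarrow>\<^sub>E space D"
            using that by (simp_all add: sample_measure_def space_PiM)
          show "\<bar>W (x(i := z)) - W x\<bar> \<le> 2 * L / real m"
            if "x \<in> {..<m} \<rightarrow>\<^sub>E space D" "i \<in> {..<m}" "z \<in> space D" for x i z
            using W_diff[of x i z] that by (simp add: sample_measure_def space_PiM)
        qed simp
        then show ?thesis using True by simp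
      qed
      have "integral\<^sup>L ?P W = W S" if "S \<in> space ?P" for S
      proof -
        have "integral\<^sup>L ?P W = (\<integral>S'. W S \<partial>?P)"
          by (intro Bochner_Integration.integral_cong refl const that)
        then show ?thesis by (simp add: P.prob_space)
      qed
      then have "Bad = {}"
        using \<open>t \<ge> 0\<close> by (auto simp: Bad_def)
      then show ?thesis using \<open>\<delta> > 0\<close> by simp
    next
      case False
      let ?d = "\<Sum>i<m. (2 * L / real m)\<^sup>2"
      have d: "?d = 4 * L\<^sup>2 / real m"
        using \<open>m > 0\<close> by (simp add: field_simps power2_eq_square)
      have "measure ?P Bad \<le> measure ?P {S \<in> space ?P. W S \<ge> integral\<^sup>L ?P W + t}"
        by (intro P.finite_measure_mono) (auto simp: Bad_def)
      also have "\<dots> \<le> exp (- 2 * t\<^sup>2 / ?d)"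
        unfolding sample_measure_def
        using W W_diff \<open>t \<ge> 0\<close> False \<open>m > 0\<close> \<open>prob_space D\<close>
        by (intro McDiarmid_ineq_ge) (auto simp: sample_measure_def)
      \<comment> \<open>The value of \<open>t\<close> is made for this:
        \<open>t\<^sup>2 = 2 * L\<^sup>2 * ln (2 / \<delta>) / m\<close> against
        \<open>?d = 4 * L\<^sup>2 / m\<close>. One tail suffices, so the failure probability is even
        at most \<open>\<delta> / 2\<close>.\<close>
      also have "- 2 * t\<^sup>2 / ?d = - ln (2 / \<delta>)"
        using False \<open>m > 0\<close> ln_pos by (simp add: d t_def power_mult_distrib field_simps) (simp add: power2_eq_square)
      also have "exp (- ln (2 / \<delta>)) = \<delta> / 2"
        using \<open>\<delta> > 0\<close> by (simp add: exp_minus)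
      finally show ?thesis using \<open>\<delta> > 0\<close> by simp
    qed
    then have "measure ?P (space ?P - Bad) \<ge> 1 - \<delta>"
      by (simp add: P.prob_compl)
    moreover have "\<bar>gen_gap D loss m S h - gen_gap D loss m S h'\<bar>
        \<le> (4 * rademacher_complexity D H loss m + t) * d_kron h h'"
      if "S \<in> space ?P - Bad" "h \<in> H" "h' \<in> H" for S h h'
      using dom[of S h h'] that EW by (auto simp: Bad_def d_kron_def)
    ultimately show ?thesis
      unfolding t_def by (intro bexI[where x = "space ?P - Bad"]) auto
  qed
qed

end
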